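(* Let $n=2$, $\gamma\in\mathbb{C}\setminus\{0\}$, $\lambda_{12}=\lambda_1-\lambda_2$, $\lambda_{21}=-\lambda_{12}$. Let $f=f(\lambda_1,\lambda_2)$ be a function that is $\gamma$-periodic in each of $\lambda_1$ and $\lambda_2$. Let $$\hat B^\infty_{12}=e_{11}\otimes p_1+e_{22}\otimes p_2,$$ $$p_1=\frac{\lambda_{12}}{\lambda_{12}+\gamma}e_{11}+e_{22}-\frac{\gamma}{\lambda_{21}-\gamma}e_{12},\qquad p_2=\frac{\lambda_{21}}{\lambda_{21}+\gamma}e_{22}+e_{11}-\frac{\gamma}{\lambda_{12}-\gamma}e_{21},$$ $\hat C^\infty_{12}=\hat B^\infty_{21}$, $$\hat A^\infty_{12}=\sum_{i=1}^2e_{ii}\otimes e_{ii}+\sum_{i\neq j}\left[\left(1-\frac{\gamma}{\lambda_{ij}}\right)e_{ii}\otimes e_{jj}+\frac{\gamma}{\lambda_{ij}}e_{ij}\otimes e_{ji}+\frac{\gamma}{\lambda_{ji}}\left(e_{ii}\otimes e_{ij}-e_{ij}\otimes e_{ii}\right)\right],$$ $$D^\infty_{12}=1\otimes1+\sum_{i\neq j}\frac{\gamma}{\lambda_{ij}}\left(e_{ij}\otimes e_{ji}-e_{ii}\otimes e_{jj}\right).$$ Then the invertible matrix $$\hat K(\lambda)=\begin{pmatrix}1-\frac{f}{\lambda_{12}}&\frac{f}{\lambda_{12}}\\[2pt]-\frac{f}{\lambda_{12}}&1+\frac{f}{\lambda_{12}}\end{pmatrix}$$ is a solution of the constant semi-dynamical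 reflection equation $$\hat A^\infty_{12}\,\hat K_1(\lambda)\,\hat B^\infty_{12}\,\hat K_2(\lambda+\gamma h_1)=\hat K_2(\lambda)\,\hat C^\infty_{12}\,\hat K_1(\lambda+\gamma h_2)\,D^\infty_{12}.$$
   Context: $\lambda=(\lambda_1,\lambda_2)$ are complex variables; $e_{ij}$ are the standard $2\times2$ matrix units; $\hat K_1=\hat K\otimes 1$, $\hat K_2=1\otimes\hat K$; $\hat K_2(\lambda+\gamma h_1)=\sum_{j=1}^2e_{jj}\otimes\hat K(\lambda+\gamma\varepsilon_j)$ and $\hat K_1(\lambda+\gamma h_2)=\sum_{j=1}^2\hat K(\lambda+\gamma\varepsilon_j)\otimes e_{jj}$, where $\lambda+\gamma\varepsilon_j$ is $\lambda$ with $\lambda_j$ replaced by $\lambda_j+\gamma$. $M_{21}$ denotes $M_{12}$ with tensor factors exchanged. *)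

theory Defs
  imports "HOL-Analysis.Analysis"
begin

type_synonym mat2 = "complex^2^2"
type_synonym mat22 = "complex^(2 \<times> 2)^(2 \<times> 2)"

definition scale_mat :: "'a::times \<Rightarrow> 'a^'n^'m \<Rightarrow> 'a^'n^'m"  (infixr "*\<^sub>m" 78)
  where "c *\<^sub>m M = (\<chi> i j. c * M $ i $ j)"

definition kron :: "'a::times^'n^'m \<Rightarrow> 'a^'q^'p \<Rightarrow> 'a^('n \<times> 'q)^('m \<times> 'p)"  (infixr "\<otimes>\<^sub>k" 76)
  where "M \<otimes>\<^sub>k N = (\<chi> r c. M $ fst r $ fst c * N $ snd r $ snd c)"

text \<open>\<open>M\<^sub>2\<^sub>1\<close>: only the tensor factors are exchanged; the components of \<open>\<lambda>\<close> are not.\<close>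
definition swap_factors :: "'a^('n::finite \<times> 'n)^('n \<times> 'n) \<Rightarrow> 'a^('n \<times> 'n)^('n \<times> 'n)"
  where "swap_factors M = (\<chi> r c. M $ (snd r, fst r) $ (snd c, fst c))"

definition E :: "2 \<Rightarrow> 2 \<Rightarrow> mat2"
  where "E i j = (\<chi> a b. if a = i \<and> b = j then 1 else 0)"

definition dif :: "complex^2 \<Rightarrow> 2 \<Rightarrow> 2 \<Rightarrow> complex"
  where "dif l i j = l $ i - l $ j"

definition shift :: "complex \<Rightarrow> 2 \<Rightarrow> complex^2 \<Rightarrow> complex^2"
  where "shift g j l = l + axis j g"

definition leg1 :: "mat2 \<Rightarrow> mat22"
  where "leg1 K = K \<otimes>\<^sub>k mat 1"

definition leg2 :: "mat2 \<Rightarrow> mat22"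
  where "leg2 K = mat 1 \<otimes>\<^sub>k K"

text \<open>\<open>K\<^sub>2(\<lambda> + \<gamma> h\<^sub>1)\<close> and \<open>K\<^sub>1(\<lambda> + \<gamma> h\<^sub>2)\<close>.\<close>
definition leg2_h1 :: "complex \<Rightarrow> (complex^2 \<Rightarrow> mat2) \<Rightarrow> complex^2 \<Rightarrow> mat22"
  where "leg2_h1 g K l = (\<Sum>j\<in>UNIV. E j j \<otimes>\<^sub>k K (shift g j l))"

definition leg1_h2 :: "complex \<Rightarrow> (complex^2 \<Rightarrow> mat2) \<Rightarrow> complex^2 \<Rightarrow> mat22"
  where "leg1_h2 g K l = (\<Sum>j\<in>UNIV. K (shift g j l) \<otimes>\<^sub>k E j j)"

definition p1 :: "complex \<Rightarrow> complex^2 \<Rightarrow> mat2"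
  where "p1 g l = (dif l 1 2 / (dif l 1 2 + g)) *\<^sub>m E 1 1 + E 2 2 - (g / (dif l 2 1 - g)) *\<^sub>m E 1 2"

definition p2 :: "complex \<Rightarrow> complex^2 \<Rightarrow> mat2"
  where "p2 g l = (dif l 2 1 / (dif l 2 1 + g)) *\<^sub>m E 2 2 + E 1 1 - (g / (dif l 1 2 - g)) *\<^sub>m E 2 1"

definition Binf :: "complex \<Rightarrow> complex^2 \<Rightarrow> mat22"
  where "Binf g l = E 1 1 \<otimes>\<^sub>k p1 g l + E 2 2 \<otimes>\<^sub>k p2 g l"

definition Cinf :: "complex \<Rightarrow> complex^2 \<Rightarrow> mat22"
  where "Cinf g l = swap_factors (Binf g l)"

definition Ainf :: "complex \<Rightarrow> complex^2 \<Rightarrow> mat22"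
  where "Ainf g l = (\<Sum>i\<in>UNIV. E i i \<otimes>\<^sub>k E i i) +
    (\<Sum>i\<in>UNIV. \<Sum>j\<in>UNIV - {i}.
       (1 - g / dif l i j) *\<^sub>m (E i i \<otimes>\<^sub>k E j j)
     + (g / dif l i j) *\<^sub>m (E i j \<otimes>\<^sub>k E j i)
     + (g / dif l j i) *\<^sub>m (E i i \<otimes>\<^sub>k E i j - E i j \<otimes>\<^sub>k E i i))"

definition Dinf :: "complex \<Rightarrow> complex^2 \<Rightarrow> mat22"
  where "Dinf g l = mat 1 \<otimes>\<^sub>k mat 1 +
    (\<Sum>i\<in>UNIV. \<Sum>j\<in>UNIV - {i}. (g / dif l i j) *\<^sub>m (E i j \<otimes>\<^sub>k E j i - E i i \<otimes>\<^sub>k E j j))"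

definition Khat :: "(complex^2 \<Rightarrow> complex) \<Rightarrow> complex^2 \<Rightarrow> mat2"
  where "Khat f l = vector
    [vector [1 - f l / dif l 1 2, f l / dif l 1 2],
     vector [- (f l / dif l 1 2), 1 + f l / dif l 1 2]]"

end

theory Submission
  imports Defs
begin

text \<open>Periodicity makes \<open>f\<close> take the same value at \<lambda> and at its two
  shifts, so once \<lambda> is fixed both sides of the reflection equation depend only on three
  numbers: this value, \<gamma> and x = \<lambda>_1 - \<lambda>_2. Written in the basis e_i
  \<otimes> e_j, the equation becomes 16 scalar identities, polynomial of degree at most two in the
  value of \<open>f\<close>, with coefficients rational in x and \<gamma> and poles only at x = 0,
  \<gamma>, -\<gamma>. Clearing denominators turns them into polynomial identities. The
  \<open>_explicit\<close> lemmas supply the eight factors, \<open>of_rows_mult\<close> the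
  products, and \<open>reflection_equation\<close> the comparison. Invertibility is separate:
  \<open>Khat\<close> has determinant 1.\<close>

lemma sum_UNIV_22: "sum h (UNIV :: (2 \<times> 2) set) = h (1,1) + h (1,2) + h (2,1) + h (2,2)"
  by (simp add: UNIV_Times_UNIV[symmetric] sum.cartesian_product' sum_2 add.assoc
        del: UNIV_Times_UNIV)

text \<open>Lexicographic numbering of the basis e_i \<otimes> e_j, starting from 0 to agree with
  list indexing.\<close>

definition pos :: "2 \<times> 2 \<Rightarrow> nat"
  where "pos r = (if fst r = 1 then 0 else 2) + (if snd r = 1 then 0 else 1)"

text \<open>Literal notation for matrices indexed by pairs; with literal lists a product can be
  computed by rewriting.\<close>

definition of_rows :: "complex list list \<Rightarrow> mat22"
  where "of_rows xss = (\<chi> r c. xss ! pos r ! pos c)"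

lemma of_rows_eqI:
  assumes "\<forall>i j k l. M $ (i,j) $ (k,l) = xss ! pos (i,j) ! pos (k,l)"
  shows "M = of_rows xss"
  using assms by (simp add: of_rows_def vec_eq_iff split_paired_All)

lemma of_rows_mult:
  "of_rows [[a11,a12,a13,a14],
            [a21,a22,a23,a24],
            [a31,a32,a33,a34],
            [a41,a42,a43,a44]] **
   of_rows [[b11,b12,b13,b14],
            [b21,b22,b23,b24],
            [b31,b32,b33,b34],
            [b41,b42,b43,b44]] =
   of_rows [[a11*b11+a12*b21+a13*b31+a14*b41, a11*b12+a12*b22+a13*b32+a14*b42,
             a11*b13+a12*b23+a13*b33+a14*b43, a11*b14+a12*b24+a13*b34+a14*b44],
            [a21*b11+a22*b21+a23*b31+a24*b41, a21*b12+a22*b22+a23*b32+a24*b42,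
             a21*b13+a22*b23+a23*b33+a24*b43, a21*b14+a22*b24+a23*b34+a24*b44],
            [a31*b11+a32*b21+a33*b31+a34*b41, a31*b12+a32*b22+a33*b32+a34*b42,
             a31*b13+a32*b23+a33*b33+a34*b43, a31*b14+a32*b24+a33*b34+a34*b44],
            [a41*b11+a42*b21+a43*b31+a44*b41, a41*b12+a42*b22+a43*b32+a44*b42,
             a41*b13+a42*b23+a43*b33+a44*b43, a41*b14+a42*b24+a43*b34+a44*b44]]"
  by (rule of_rows_eqI) (simp add: of_rows_def pos_def forall_2 matrix_matrix_mult_def sum_UNIV_22)

text \<open>Orients every difference the same way, so that x is the only variable left from
  \<lambda>.\<close>

lemma dif_swap: "dif l 2 1 = - dif l 1 2"
  by (simp add: dif_def)

lemma dif_shift: "dif (shift g 1 l) 1 2 = dif l 1 2 + g" "dif (shift g 2 l) 1 2 = dif l 1 2 - g"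
  by (simp_all add: dif_def shift_def axis_def)

lemma UNIV_minus_2: "UNIV - {1::2} = {2}" "UNIV - {2::2} = {1}"
  by (auto simp: UNIV_2)

lemmas entry_simps =
  pos_def forall_2 kron_def scale_mat_def E_def mat_def sum_2 dif_swap UNIV_minus_2

lemma Ainf_explicit:
  fixes g l defines "t \<equiv> g / dif l 1 2"
  shows "Ainf g l = of_rows [[1, -t, t, 0],
                             [0, 1 - t, t, 0],
                             [0, -t, 1 + t, 0],
                             [0, -t, t, 1]]"
  by (rule of_rows_eqI) (simp add: Ainf_def entry_simps t_def)

lemma Dinf_explicit:
  fixes g l defines "t \<equiv> g / dif l 1 2"
  shows "Dinf g l = of_rows [[1, 0, 0, 0],
                             [0, 1 - t, t, 0],
                             [0, -t, 1 + t, 0],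
                             [0, 0, 0, 1]]"
  by (rule of_rows_eqI) (simp add: Dinf_def entry_simps t_def)

lemma Binf_explicit:
  fixes g l defines "x \<equiv> dif l 1 2"
  assumes "x - g \<noteq> 0" "x + g \<noteq> 0"
  shows "Binf g l = of_rows [[x / (x + g), g / (x + g), 0, 0],
                             [0, 1, 0, 0],
                             [0, 0, 1, 0],
                             [0, 0, - (g / (x - g)), x / (x - g)]]"
  using assms(2,3) unfolding x_def
  by (intro of_rows_eqI)
     (simp add: Binf_def p1_def p2_def entry_simps divide_simps, auto simp: algebra_simps)

text \<open>Exchanging the tensor factors swaps the two middle basis vectors, hence the middle rows
  and the middle columns of \<open>Binf\<close>.\<close>

lemma Cinf_explicit:
  fixes g l defines "x \<equiv> dif l 1 2"
  assumes "x - g \<noteq> 0" "x + g \<noteq> 0"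
  shows "Cinf g l = of_rows [[x / (x + g), 0, g / (x + g), 0],
                             [0, 1, 0, 0],
                             [0, 0, 1, 0],
                             [0, - (g / (x - g)), 0, x / (x - g)]]"
  by (rule of_rows_eqI)
     (simp add: Cinf_def swap_factors_def Binf_explicit[OF assms(2,3)[unfolded x_def]]
        of_rows_def pos_def forall_2 x_def)

lemma leg1_Khat_explicit:
  fixes f l defines "u \<equiv> f l / dif l 1 2"
  shows "leg1 (Khat f l) = of_rows [[1 - u, 0, u, 0],
                                    [0, 1 - u, 0, u],
                                    [-u, 0, 1 + u, 0],
                                    [0, -u, 0, 1 + u]]"
  by (rule of_rows_eqI) (simp add: leg1_def Khat_def entry_simps u_def)

lemma leg2_Khat_explicit:
  fixes f l defines "u \<equiv> f l / dif l 1 2"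
  shows "leg2 (Khat f l) = of_rows [[1 - u, u, 0, 0],
                                    [-u, 1 + u, 0, 0],
                                    [0, 0, 1 - u, u],
                                    [0, 0, -u, 1 + u]]"
  by (rule of_rows_eqI) (simp add: leg2_def Khat_def entry_simps u_def)

context
  fixes g :: complex and f :: "complex^2 \<Rightarrow> complex"
  assumes periodic: "\<And>j l. f (shift g j l) = f l"
begin

text \<open>The numerator stays \<open>f l\<close> by periodicity; only the denominator moves, to x
  + g in the block of e_11 and to x - g in that of e_22.\<close>

lemma leg2_h1_Khat_explicit:
  fixes l defines "v \<equiv> f l / (dif l 1 2 + g)" and "w \<equiv> f l / (dif l 1 2 - g)"
  shows "leg2_h1 g (Khat f) l = of_rows [[1 - v, v, 0, 0],
                                         [-v, 1 + v, 0, 0],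
                                         [0, 0, 1 - w, w],
                                         [0, 0, -w, 1 + w]]"
  by (rule of_rows_eqI)
     (simp add: leg2_h1_def Khat_def entry_simps periodic dif_shift v_def w_def)

lemma leg1_h2_Khat_explicit:
  fixes l defines "v \<equiv> f l / (dif l 1 2 + g)" and "w \<equiv> f l / (dif l 1 2 - g)"
  shows "leg1_h2 g (Khat f) l = of_rows [[1 - v, 0, v, 0],
                                         [0, 1 - w, 0, w],
                                         [-v, 0, 1 + v, 0],
                                         [0, -w, 0, 1 + w]]"
  by (rule of_rows_eqI)
     (simp add: leg1_h2_def Khat_def entry_simps periodic dif_shift v_def w_def)

lemma reflection_equation:
  assumes "dif l 1 2 \<notin> {0, g, - g}"
  shows "Ainf g l ** leg1 (Khat f l) ** Binf g l ** leg2_h1 g (Khat f) l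
       = leg2 (Khat f l) ** Cinf g l ** leg1_h2 g (Khat f) l ** Dinf g l"
proof -
  define x where "x = dif l 1 2"
  have nz: "x \<noteq> 0" "x - g \<noteq> 0" "x + g \<noteq> 0"
    using assms by (auto simp: x_def add_eq_0_iff2)
  show ?thesis
    unfolding Ainf_explicit Dinf_explicit Binf_explicit[OF nz(2,3)[unfolded x_def]]
      Cinf_explicit[OF nz(2,3)[unfolded x_def]] leg1_Khat_explicit leg2_Khat_explicit
      leg2_h1_Khat_explicit leg1_h2_Khat_explicit of_rows_mult x_def[symmetric]
    \<comment> \<open>Congruence for \<open>of_rows\<close> and \<open>Cons\<close> splits the goal
      into equations between entries; \<open>nz\<close> permits clearing their denominators, and
      expansion settles the rest.\<close>
    by (intro arg_cong[where f=of_rows] arg_cong2[where f=Cons] refl;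
        insert nz; simp add: divide_simps; simp add: algebra_simps)
qed

end

lemma invertible_Khat:
  assumes "dif l 1 2 \<noteq> 0"
  shows "invertible (Khat f l)"
proof -
  \<comment> \<open>With u = f/x the matrix is 1 + u N for a nilpotent N, and its determinant is (1
    - u)(1 + u) + u * u = 1.\<close>
  have "det (Khat f l) = 1"
    using assms by (simp add: det_2 Khat_def field_simps)
  then show ?thesis
    by (simp add: invertible_det_nz)
qed

theorem mainTheorem6:
  fixes \<gamma> :: complex and f :: "complex^2 \<Rightarrow> complex"
  assumes "\<gamma> \<noteq> 0"
    and "\<And>j l. f (shift \<gamma> j l) = f l"
  shows "(\<forall>l. dif l 1 2 \<noteq> 0 \<longrightarrow> invertible (Khat f l)) \<and>
    (\<forall>l. dif l 1 2 \<notin> {0, \<gamma>, - \<gamma>} \<longrightarrow>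
       Ainf \<gamma> l ** leg1 (Khat f l) ** Binf \<gamma> l ** leg2_h1 \<gamma> (Khat f) l
     = leg2 (Khat f l) ** Cinf \<gamma> l ** leg1_h2 \<gamma> (Khat f) l ** Dinf \<gamma> l)"
  using assms(2) by (simp add: invertible_Khat reflection_equation)

end
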